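(* Let $\mathcal Q$ be a logic on a Hilbert space $\mathcal H$. For any $u\in\mathbf R^{(\mathcal Q)}$: (i) $u(\check r)=[\![\check r\in u]\!]$ for all $r\in\mathbf Q$; (ii) $\underline{\mathrm{Or}}(u)=1$.
   Context: $\mathcal Q(\mathcal H)$ is the lattice of orthogonal projections on $\mathcal H$ (order by inclusion of ranges, $\wedge,\vee$ and arbitrary $\bigwedge,\bigvee$ via intersection / closed span of union of ranges, $P^\perp=1-P$). $\mathcal A^!=\{P\in\mathcal Q(\mathcal H):PQ=QP\ \forall Q\in\mathcal A\}$; a logic is $\mathcal Q\subseteq\mathcal Q(\mathcal H)$ with $\mathcal Q=\mathcal Q^{!!}$. $P\Rightarrow Q=P^\perp\vee(P\wedge Q)$, $P\Leftrightarrow Q=(P\Rightarrow Q)\wedge(Q\Rightarrow P)$. For $\mathcal A\subseteq\mathcal Q(\mathcal H)$, $\mathrm{cdom}(\mathcal A)=\bigvee\{E\in\mathcal A^!:(P_1\wedge E)(P_2\wedge E)=(P_2\wedge E)(P_1\wedge E)\ \forall P_1,P_2\in\mathcal A\}$. $V^{(\mathcal Q)}=\bigcup_\alpha V^{(\mathcal Q)}_\alpha$, $V^{(\mathcal Q)}_\alpha$ the set of functions $u$ with values in $\mathcal Q$ and $\mathrm{dom}(u)\subseteq\bigcup_{\beta<\alpha}V^{(\mathcal Q)}_\beta$. Support $L(u)=\bigcup_{x\in\mathrm{dom}(u)}L(x)\cup\{u(x):x\in\mathrm{dom}(u)\}$; $\underline{\mathrm{Or}}(u)=\mathrm{cdom}(L(u))$.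 Truth values: $[\![u=v]\!]=\bigwedge_{u'\in\mathrm{dom}(u)}(u(u')\Rightarrow[\![u'\in v]\!])\wedge\bigwedge_{v'\in\mathrm{dom}(v)}(v(v')\Rightarrow[\![v'\in u]\!])$, $[\![u\in v]\!]=\bigvee_{v'\in\mathrm{dom}(v)}(v(v')\wedge[\![u=v']\!])$, $[\![\neg\phi]\!]=[\![\phi]\!]^\perp$, connectives by lattice operations, $[\![(\forall x\in u)\phi]\!]=\bigwedge_{u'\in\mathrm{dom}(u)}(u(u')\Rightarrow[\![\phi(u')]\!])$, $[\![(\exists x\in u)\phi]\!]=\bigvee_{u'\in\mathrm{dom}(u)}(u(u')\wedge[\![\phi(u')]\!])$. For a set $v$, $\check v=\{(\check w,1):w\in v\}$; $\mathbf Q$ is the rationals. $\mathbf R(x)$ is $x\subseteq\check{\mathbf Q}\wedge\exists y\in\check{\mathbf Q}(y\in x)\wedge\exists y\in\check{\mathbf Q}(y\notin x)\wedge\forall y\in\check{\mathbf Q}(y\in x\Leftrightarrow\forall z\in\check{\mathbf Q}(y<z\Rightarrow z\in x))$ ($x\subseteq y$ abbreviates $\forall z\in x(z\in y)$, $<$ the order of rationals, $[\![\check r<\check s]\!]=1$ if $r<s$ and $0$ otherwise); $\mathbf R^{(\mathcal Q)}=\{u\in V^{(\mathcal Q)}:\mathrm{dom}(u)=\{\check r:r\in\mathbf Q\},\ [\![\mathbf R(u)]\!]=1\}$. *)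

theory Defs
  imports
    "HOL-Analysis.Analysis"
    "HOL-Library.Complemented_Lattices"
    "HOL-Library.Infinite_Typeclass"
    "HOL-Library.Multiset"
begin

section \<open>Complex Hilbert spaces\<close>

text \<open>The inner product is linear in its second argument. Completeness of the norm is part of
  \<^class>\<open>banach\<close>; positivity and definiteness of the inner product are contained in the
  last axiom.\<close>

class complex_hilbert = banach +
  fixes scaleC :: "complex \<Rightarrow> 'a \<Rightarrow> 'a" (infixr "*\<^sub>C" 75)
    and cinner :: "'a \<Rightarrow> 'a \<Rightarrow> complex"
  assumes scaleC_add_right: "a *\<^sub>C (x + y) = a *\<^sub>C x + a *\<^sub>C y"
    and scaleC_add_left: "(a + b) *\<^sub>C x = a *\<^sub>C x + b *\<^sub>C x"
    and scaleC_scaleC: "a *\<^sub>C (b *\<^sub>C x) = (a * b) *\<^sub>C x"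
    and scaleC_of_real: "complex_of_real r *\<^sub>C x = r *\<^sub>R x"
    and cinner_commute: "cinner x y = cnj (cinner y x)"
    and cinner_add_right: "cinner x (y + z) = cinner x y + cinner x z"
    and cinner_scaleC_right: "cinner x (a *\<^sub>C y) = a * cinner x y"
    and cinner_self: "cinner x x = complex_of_real ((norm x)\<^sup>2)"

global_interpretation cvs: vector_space "scaleC :: complex \<Rightarrow> 'a \<Rightarrow> 'a::complex_hilbert"
  defines csubspace = cvs.subspace and cspan = cvs.span
  using scaleC_of_real[of 1]
  by unfold_locales (simp_all add: scaleC_add_right scaleC_add_left scaleC_scaleC)

lemma cinner_add_left: "cinner (x + y) z = cinner x z + cinner y (z::'a::complex_hilbert)"
  by (metis cinner_add_right cinner_commute complex_cnj_add)

lemma cinner_scaleC_left: "cinner (a *\<^sub>C x) y = cnj a * cinner x (y::'a::complex_hilbert)"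
  by (metis cinner_scaleC_right cinner_commute complex_cnj_mult)

lemma scaleC_minus1: "(-1) *\<^sub>C x = - (x::'a::complex_hilbert)"
  by (simp add: cvs.scale_minus_left)

lemma cinner_minus_right: "cinner x (- y) = - cinner x (y::'a::complex_hilbert)"
  using cinner_scaleC_right[of x "-1" y] by (simp add: scaleC_minus1)

lemma cinner_minus_left: "cinner (- x) y = - cinner x (y::'a::complex_hilbert)"
  by (metis cinner_minus_right cinner_commute complex_cnj_minus)

lemma cinner_diff_right: "cinner x (y - z) = cinner x y - cinner x (z::'a::complex_hilbert)"
  using cinner_add_right[of x y "- z"] by (simp add: cinner_minus_right)

lemma cinner_diff_left: "cinner (x - y) z = cinner x z - cinner y (z::'a::complex_hilbert)"
  using cinner_add_left[of x "- y" z] by (simp add: cinner_minus_left)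

lemmas cinner_simps = cinner_add_left cinner_add_right cinner_diff_left cinner_diff_right
  cinner_scaleC_left cinner_scaleC_right

lemma cinner_zero: "cinner x 0 = 0" "cinner 0 (x::'a::complex_hilbert) = 0"
  using cinner_diff_right[of x 0 0] cinner_diff_left[of 0 0 x] by simp_all

lemma cinner_self_eq_0: "cinner x x = 0 \<longleftrightarrow> (x::'a::complex_hilbert) = 0"
  by (simp add: cinner_self)

lemma norm_sq_cinner: "(norm x)\<^sup>2 = Re (cinner x (x::'a::complex_hilbert))"
  by (simp add: cinner_self)

lemma norm_scaleC: "norm (a *\<^sub>C x) = cmod a * norm (x::'a::complex_hilbert)"
proof -
  have "complex_of_real ((norm (a *\<^sub>C x))\<^sup>2) = (a * cnj a) * cinner x x"
    unfolding cinner_self[symmetric] cinner_simps by (simp only: mult_ac)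
  also have "\<dots> = complex_of_real ((cmod a * norm x)\<^sup>2)"
    unfolding cinner_self complex_norm_square[symmetric] by (simp only: power_mult_distrib of_real_mult)
  finally have "(norm (a *\<^sub>C x))\<^sup>2 = (cmod a * norm x)\<^sup>2"
    by (simp only: of_real_eq_iff)
  then show ?thesis
    by (rule power2_eq_imp_eq) simp_all
qed

lemma bounded_linear_scaleC: "bounded_linear (\<lambda>x::'a::complex_hilbert. a *\<^sub>C x)"
proof (rule bounded_linear_intro[where K = "cmod a"])
  show "a *\<^sub>C (r *\<^sub>R x) = r *\<^sub>R (a *\<^sub>C x)" for r and x :: 'a
    by (simp flip: scaleC_of_real add: scaleC_scaleC mult.commute)
qed (simp_all add: scaleC_add_right norm_scaleC mult.commute)

lemma parallelogram:
  "(norm (x + y))\<^sup>2 + (norm (x - y))\<^sup>2 = 2 * (norm x)\<^sup>2 + 2 * (norm (y::'a::complex_hilbert))\<^sup>2"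
  by (simp add: norm_sq_cinner cinner_simps)

lemma csubspace_closure: "csubspace (closure S)" if "csubspace (S::'a::complex_hilbert set)"
proof (rule cvs.subspaceI)
  show "0 \<in> closure S"
    using that closure_subset cvs.subspace_0 by blast
next
  fix x y assume "x \<in> closure S" "y \<in> closure S"
  then obtain f g where "\<forall>n. f n \<in> S" "f \<longlonglongrightarrow> x" "\<forall>n. g n \<in> S" "g \<longlonglongrightarrow> y"
    unfolding closure_sequential by blast
  then have "\<forall>n. f n + g n \<in> S" "(\<lambda>n. f n + g n) \<longlonglongrightarrow> x + y"
    using cvs.subspace_add[OF that] tendsto_add by blast+
  then show "x + y \<in> closure S"
    unfolding closure_sequential by (intro exI[of _ "\<lambda>n. f n + g n"]) simp
next
  fix c x assume "x \<in> closure S"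
  then obtain f where "\<forall>n. f n \<in> S" "f \<longlonglongrightarrow> x"
    unfolding closure_sequential by blast
  then have "\<forall>n. c *\<^sub>C f n \<in> S" "(\<lambda>n. c *\<^sub>C f n) \<longlonglongrightarrow> c *\<^sub>C x"
    using cvs.subspace_scale[OF that] bounded_linear.tendsto[OF bounded_linear_scaleC] by blast+
  then show "c *\<^sub>C x \<in> closure S"
    unfolding closure_sequential by (intro exI[of _ "\<lambda>n. c *\<^sub>C f n"]) simp
qed

lemma closest_point_exists:
  fixes S :: "'a::complex_hilbert set"
  assumes "closed S" "csubspace S"
  shows "\<exists>p\<in>S. \<forall>s\<in>S. norm (x - p) \<le> norm (x - s)"
proof -
  define d where "d = (INF s\<in>S. (norm (x - s))\<^sup>2)"
  have ne: "S \<noteq> {}"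
    using cvs.subspace_0[OF assms(2)] by blast
  have bdd: "bdd_below ((\<lambda>s. (norm (x - s))\<^sup>2) ` S)"
    by (rule bdd_belowI2[where m = 0]) simp
  have d_le: "d \<le> (norm (x - s))\<^sup>2" if "s \<in> S" for s
    unfolding d_def by (rule cINF_lower[OF bdd that])
  have "\<exists>s\<in>S. (norm (x - s))\<^sup>2 < d + 1 / (Suc n)" for n
    using cINF_less_iff[OF ne bdd, of "d + 1 / (Suc n)"] unfolding d_def by simp
  then have "\<forall>n. \<exists>s. s \<in> S \<and> (norm (x - s))\<^sup>2 < d + 1 / (Suc n)"
    by blast
  then obtain f where "\<forall>n. f n \<in> S \<and> (norm (x - f n))\<^sup>2 < d + 1 / (Suc n)"
    unfolding choice_iff ..
  then have f: "\<And>n. f n \<in> S" "\<And>n. (norm (x - f n))\<^sup>2 < d + 1 / (Suc n)"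
    by blast+
  have diff: "(norm (f m - f n))\<^sup>2 \<le> 2 / (Suc m) + 2 / (Suc n)" for m n
  proof -
    let ?h = "(1/2) *\<^sub>R (f m + f n)"
    have "?h \<in> S"
      unfolding scaleC_of_real[symmetric]
      by (intro cvs.subspace_scale cvs.subspace_add f(1) assms(2))
    then have 1: "d \<le> (norm (x - ?h))\<^sup>2"
      by (rule d_le)
    have "(x - f m) + (x - f n) = 2 *\<^sub>R (x - ?h)"
      by (simp add: algebra_simps scaleR_2)
    then have "(norm ((x - f m) + (x - f n)))\<^sup>2 = 4 * (norm (x - ?h))\<^sup>2"
      by (simp add: power_mult_distrib)
    moreover have "norm ((x - f m) - (x - f n)) = norm (f m - f n)"
      by (simp add: norm_minus_commute)
    ultimately have "4 * (norm (x - ?h))\<^sup>2 + (norm (f m - f n))\<^sup>2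
        = 2 * (norm (x - f m))\<^sup>2 + 2 * (norm (x - f n))\<^sup>2"
      using parallelogram[of "x - f m" "x - f n"] by simp
    then have "(norm (f m - f n))\<^sup>2 \<le> 2 * (1 / (Suc m)) + 2 * (1 / (Suc n))"
      using 1 f(2)[of m] f(2)[of n] by linarith
    then show ?thesis by simp
  qed
  have "Cauchy f"
  proof (rule CauchyI)
    fix e :: real assume "e > 0"
    then have "e\<^sup>2 / 4 > 0" by simp
    from reals_Archimedean[OF this] obtain N where "inverse (real (Suc N)) < e\<^sup>2 / 4" ..
    then have N: "4 / real (Suc N) < e\<^sup>2"
      by (simp add: field_simps)
    show "\<exists>M. \<forall>m\<ge>M. \<forall>n\<ge>M. norm (f m - f n) < e"
    proof (intro exI allI impI)
      fix m n assume "N \<le> m" "N \<le> n"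
      then have "2 / real (Suc m) \<le> 2 / real (Suc N)" "2 / real (Suc n) \<le> 2 / real (Suc N)"
        by (auto intro!: divide_left_mono)
      then have "(norm (f m - f n))\<^sup>2 < e\<^sup>2"
        using diff[of m n] N by linarith
      then show "norm (f m - f n) < e"
        by (rule power2_less_imp_less) (use \<open>e > 0\<close> in simp)
    qed
  qed
  then obtain p where p: "f \<longlonglongrightarrow> p"
    unfolding Cauchy_convergent_iff convergent_def ..
  then have "p \<in> S"
    by (rule closed_sequentially[OF assms(1) f(1)])
  have l1: "(\<lambda>n. (norm (x - f n))\<^sup>2) \<longlonglongrightarrow> (norm (x - p))\<^sup>2"
    by (intro tendsto_intros p)
  have "(\<lambda>n. d + 1 / (Suc n)) \<longlonglongrightarrow> d + 0"
    by (intro tendsto_intros lim_1_over_n[THEN LIMSEQ_Suc])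
  then have l2: "(\<lambda>n. d + 1 / (Suc n)) \<longlonglongrightarrow> d"
    by (simp only: add_0_right)
  have le: "(norm (x - p))\<^sup>2 \<le> d"
    by (rule LIMSEQ_le[OF l1 l2]) (use f(2) in \<open>auto intro: less_imp_le\<close>)
  have "norm (x - p) \<le> norm (x - s)" if "s \<in> S" for s
    by (rule power2_le_imp_le[OF order_trans[OF le d_le[OF that]]]) simp
  then show ?thesis
    using \<open>p \<in> S\<close> by blast
qed

lemma orthogonal_decomposition:
  fixes S :: "'a::complex_hilbert set"
  assumes "closed S" "csubspace S"
  shows "\<exists>p\<in>S. \<forall>s\<in>S. cinner s (x - p) = 0"
proof -
  obtain p where p: "p \<in> S" "\<And>s. s \<in> S \<Longrightarrow> norm (x - p) \<le> norm (x - s)"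
    using closest_point_exists[OF assms] by blast
  have "cinner s (x - p) = 0" if s: "s \<in> S" for s
  proof -
    define w where "w = x - p"
    define a where "a = cinner s w"
    define e where "e = 1 / ((norm s)\<^sup>2 + 1)"
    define t where "t = complex_of_real e * a"
    have e: "e > 0" "e * (norm s)\<^sup>2 < 1"
      unfolding e_def using zero_le_power2[of "norm s"]
      by (simp_all add: add_nonneg_pos divide_less_eq)
    have "p + t *\<^sub>C s \<in> S"
      by (intro cvs.subspace_scale cvs.subspace_add p(1) s assms(2))
    from p(2)[OF this] have "norm w \<le> norm (w - t *\<^sub>C s)"
      by (simp add: w_def algebra_simps)
    then have "(norm w)\<^sup>2 \<le> (norm (w - t *\<^sub>C s))\<^sup>2"
      by (simp add: power_mono)
    also have "\<dots> = Re (cinner w w - t * cinner w s - cnj t * cinner s w + t * cnj t * cinner s s)"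
      by (simp add: norm_sq_cinner cinner_simps algebra_simps)
    also have "cinner w s = cnj a"
      unfolding a_def by (rule cinner_commute)
    also have "cinner w w - t * cnj a - cnj t * cinner s w + t * cnj t * cinner s s
        = complex_of_real ((norm w)\<^sup>2 - 2 * e * (cmod a)\<^sup>2 + e\<^sup>2 * (cmod a)\<^sup>2 * (norm s)\<^sup>2)"
    proof -
      have aa: "a * cnj a = complex_of_real ((cmod a)\<^sup>2)"
        by (simp only: complex_norm_square)
      have "t * cnj a = complex_of_real (e * (cmod a)\<^sup>2)" "cnj t * a = complex_of_real (e * (cmod a)\<^sup>2)"
        "t * cnj t = complex_of_real (e\<^sup>2 * (cmod a)\<^sup>2)"
        unfolding t_def of_real_mult aa[symmetric] by (simp_all add: power2_eq_square)
      then show ?thesis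
        unfolding a_def[symmetric] cinner_self by simp
    qed
    finally have "(norm w)\<^sup>2 \<le> (norm w)\<^sup>2 - 2 * e * (cmod a)\<^sup>2 + e\<^sup>2 * (cmod a)\<^sup>2 * (norm s)\<^sup>2"
      by (simp only: complex.sel Re_complex_of_real)
    then have "0 \<le> e * ((cmod a)\<^sup>2 * (e * (norm s)\<^sup>2 - 2))"
      by (simp add: algebra_simps power2_eq_square)
    then have "0 \<le> (cmod a)\<^sup>2 * (e * (norm s)\<^sup>2 - 2)"
      using e(1) by (simp only: zero_le_mult_iff) linarith
    moreover have "(cmod a)\<^sup>2 * (e * (norm s)\<^sup>2 - 2) \<le> (cmod a)\<^sup>2 * (-1)"
      using e(2) by (intro mult_left_mono) auto
    ultimately have "(cmod a)\<^sup>2 \<le> 0"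
      by linarith
    then have "a = 0"
      by simp
    then show ?thesis
      by (simp only: a_def w_def)
  qed
  then show ?thesis using p(1) by blast
qed

text \<open>An example, which also makes the class inhabited.\<close>

instantiation complex :: complex_hilbert
begin

definition scaleC_complex :: "complex \<Rightarrow> complex \<Rightarrow> complex" where
  "scaleC_complex a x = a * x"

definition cinner_complex :: "complex \<Rightarrow> complex \<Rightarrow> complex" where
  "cinner_complex x y = cnj x * y"

instance
  by standard
    (simp_all add: scaleC_complex_def cinner_complex_def algebra_simps scaleR_conv_of_real
      complex_norm_square del: of_real_power)

end

section \<open>The lattice of orthogonal projections\<close>

typedef (overloaded) 'a proj =
  "{P :: 'a::complex_hilbert \<Rightarrow> 'a. bounded_linear P \<and> (\<forall>a x. P (a *\<^sub>C x) = a *\<^sub>C P x) \<and>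
     (\<forall>x. P (P x) = P x) \<and> (\<forall>x y. cinner (P x) y = cinner x (P y))}"
  morphisms apply_proj Proj
  by (rule exI[of _ id]) (auto simp: id_def)

definition ran_proj :: "'a::complex_hilbert proj \<Rightarrow> 'a set" where
  "ran_proj P = range (apply_proj P)"

lemma bounded_linear_proj: "bounded_linear (apply_proj P)"
  and proj_scaleC: "apply_proj P (a *\<^sub>C x) = a *\<^sub>C apply_proj P x"
  and proj_idem: "apply_proj P (apply_proj P x) = apply_proj P x"
  and proj_selfadj: "cinner (apply_proj P x) y = cinner x (apply_proj P y)"
  for P :: "'a::complex_hilbert proj"
  using apply_proj[of P] by auto

lemma proj_diff: "apply_proj P (x - y) = apply_proj P x - apply_proj P y"
  using bounded_linear.linear[OF bounded_linear_proj[of P]] by (rule linear_diff)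

lemma proj_add: "apply_proj P (x + y) = apply_proj P x + apply_proj P y"
  using bounded_linear.linear[OF bounded_linear_proj[of P]] by (rule linear_add)

lemma proj_zero: "apply_proj P 0 = 0"
  using proj_diff[of P 0 0] by simp

lemma ran_proj_iff: "x \<in> ran_proj P \<longleftrightarrow> apply_proj P x = x"
  unfolding ran_proj_def by (auto simp: proj_idem intro: range_eqI[OF sym])

lemma proj_mem_ran: "apply_proj P x \<in> ran_proj P"
  by (simp add: ran_proj_def)

lemma proj_eq_iff_orth:
  "apply_proj P x = p \<longleftrightarrow> p \<in> ran_proj P \<and> (\<forall>s\<in>ran_proj P. cinner s (x - p) = 0)"
proof
  assume p: "apply_proj P x = p"
  have "cinner s (x - p) = 0" if "s \<in> ran_proj P" for s
  proof -
    have "cinner s (x - p) = cinner (apply_proj P s) (x - p)"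
      using that by (simp add: ran_proj_iff)
    also have "\<dots> = 0"
      unfolding proj_selfadj proj_diff
      using p proj_idem[of P x] by (simp add: cinner_zero)
    finally show ?thesis .
  qed
  then show "p \<in> ran_proj P \<and> (\<forall>s\<in>ran_proj P. cinner s (x - p) = 0)"
    using p proj_mem_ran by blast
next
  assume a: "p \<in> ran_proj P \<and> (\<forall>s\<in>ran_proj P. cinner s (x - p) = 0)"
  let ?d = "apply_proj P x - p"
  have d: "apply_proj P (x - p) = ?d"
    using a by (simp add: proj_diff ran_proj_iff)
  have "?d \<in> ran_proj P"
    using proj_mem_ran[of P "x - p"] d by simp
  then have "cinner ?d (x - p) = 0" "apply_proj P ?d = ?d"
    using a by (auto simp: ran_proj_iff)
  then have "cinner ?d ?d = 0"
    by (metis d proj_selfadj)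
  then show "apply_proj P x = p"
    by (simp add: cinner_self_eq_0)
qed

lemma ran_proj_inject: "ran_proj P = ran_proj Q \<longleftrightarrow> P = Q"
proof
  assume eq: "ran_proj P = ran_proj Q"
  have "apply_proj P x = apply_proj Q x" for x
    using eq proj_eq_iff_orth[of P x "apply_proj Q x"] proj_eq_iff_orth[of Q x "apply_proj Q x"]
    by simp
  then show "P = Q"
    by (intro iffD1[OF apply_proj_inject] ext)
qed simp

lemma csubspace_ran_proj: "csubspace (ran_proj P)"
  by (intro cvs.subspaceI) (auto simp: ran_proj_iff proj_zero proj_add proj_scaleC)

lemma closed_ran_proj: "closed (ran_proj P)"
proof -
  have "ran_proj P = {x. apply_proj P x = x}"
    by (auto simp: ran_proj_iff)
  then show ?thesis
    by (simp add: closed_Collect_eq linear_continuous_on bounded_linear_proj)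
qed

lemma ex_proj_onto:
  fixes S :: "'a::complex_hilbert set"
  assumes S: "closed S" "csubspace S"
  shows "\<exists>!P. ran_proj P = S"
proof -
  have uniq: "p = q" if "p \<in> S" "q \<in> S" "\<forall>s\<in>S. cinner s (x - p) = 0" "\<forall>s\<in>S. cinner s (x - q) = 0"
    for x p q
  proof -
    have "p - q \<in> S" by (intro cvs.subspace_diff that S)
    then have "cinner (p - q) ((x - q) - (x - p)) = 0"
      using that by (simp only: cinner_diff_right[of "p - q" "x - q" "x - p"]) simp
    then show ?thesis by (simp add: cinner_self_eq_0)
  qed
  have "\<forall>x. \<exists>p. p \<in> S \<and> (\<forall>s\<in>S. cinner s (x - p) = 0)"
    using orthogonal_decomposition[OF S] by blast
  then obtain f where "\<forall>x. f x \<in> S \<and> (\<forall>s\<in>S. cinner s (x - f x) = 0)"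
    unfolding choice_iff ..
  then have f: "\<And>x. f x \<in> S" "\<And>x s. s \<in> S \<Longrightarrow> cinner s (x - f x) = 0"
    by blast+
  have feq: "f x = p" if "p \<in> S" "\<And>s. s \<in> S \<Longrightarrow> cinner s (x - p) = 0" for x p
    using uniq f that by blast
  have add: "f (x + y) = f x + f y" for x y
  proof (rule feq)
    show "f x + f y \<in> S" by (intro cvs.subspace_add f S)
    fix s assume "s \<in> S"
    then have "cinner s ((x - f x) + (y - f y)) = 0"
      using f by (simp only: cinner_add_right) simp
    then show "cinner s (x + y - (f x + f y)) = 0" by (simp add: algebra_simps)
  qed
  have sc: "f (a *\<^sub>C x) = a *\<^sub>C f x" for a x
  proof (rule feq)
    show "a *\<^sub>C f x \<in> S" by (intro cvs.subspace_scale f S)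
    fix s assume "s \<in> S"
    then have "a * cinner s (x - f x) = 0" using f by simp
    then show "cinner s (a *\<^sub>C x - a *\<^sub>C f x) = 0" by (simp add: cinner_simps algebra_simps)
  qed
  have fix_S: "f x = x" if "x \<in> S" for x
    by (rule feq[OF that]) (simp add: cinner_zero)
  have bd: "norm (f x) \<le> norm x * 1" for x
  proof -
    have 0: "cinner (f x) (x - f x) = 0" using f by blast
    then have "cinner (x - f x) (f x) = 0" by (metis cinner_commute complex_cnj_zero)
    with 0 have "cinner x x = cinner (f x) (f x) + cinner (x - f x) (x - f x)"
      by (simp add: cinner_simps)
    then have "(norm x)\<^sup>2 = (norm (f x))\<^sup>2 + (norm (x - f x))\<^sup>2"
      unfolding norm_sq_cinner by simp
    then have "(norm (f x))\<^sup>2 \<le> (norm x)\<^sup>2"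
      by simp
    from power2_le_imp_le[OF this] show ?thesis
      by simp
  qed
  have sa: "cinner (f x) y = cinner x (f y)" for x y
  proof -
    have 1: "cinner (f x) (y - f y) = 0" "cinner (f y) (x - f x) = 0" using f by blast+
    then have "cinner (x - f x) (f y) = 0" by (metis cinner_commute complex_cnj_zero)
    with 1(1) show ?thesis by (simp add: cinner_simps)
  qed
  have "bounded_linear f"
    by (rule bounded_linear_intro[where K = 1])
      (use add sc bd in \<open>auto simp flip: scaleC_of_real\<close>)
  then have "apply_proj (Proj f) = f"
    using sc sa f fix_S by (intro Proj_inverse) auto
  then have "ran_proj (Proj f) = S"
    unfolding ran_proj_def using f(1) fix_S by auto (metis fix_S rangeI)
  then show ?thesis
    by (intro ex1I[of _ "Proj f"]) (simp_all flip: ran_proj_inject)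
qed

definition proj_onto :: "'a::complex_hilbert set \<Rightarrow> 'a proj" where
  "proj_onto S = (THE P. ran_proj P = S)"

lemma ran_proj_onto: "closed S \<Longrightarrow> csubspace S \<Longrightarrow> ran_proj (proj_onto S) = S"
  unfolding proj_onto_def using theI'[OF ex_proj_onto] .

instantiation proj :: (complex_hilbert) complete_orthomodular_lattice
begin

definition less_eq_proj :: "'a proj \<Rightarrow> 'a proj \<Rightarrow> bool" where
  "P \<le> Q \<longleftrightarrow> ran_proj P \<subseteq> ran_proj Q"

definition less_proj :: "'a proj \<Rightarrow> 'a proj \<Rightarrow> bool" where
  "P < Q \<longleftrightarrow> ran_proj P \<subset> ran_proj Q"

definition Inf_proj :: "'a proj set \<Rightarrow> 'a proj" where
  "Inf A = proj_onto (\<Inter>P\<in>A. ran_proj P)"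

definition Sup_proj :: "'a proj set \<Rightarrow> 'a proj" where
  "Sup A = proj_onto (closure (cspan (\<Union>P\<in>A. ran_proj P)))"

definition inf_proj :: "'a proj \<Rightarrow> 'a proj \<Rightarrow> 'a proj" where
  "inf P Q = proj_onto (ran_proj P \<inter> ran_proj Q)"

definition sup_proj :: "'a proj \<Rightarrow> 'a proj \<Rightarrow> 'a proj" where
  "sup P Q = proj_onto (closure (cspan (ran_proj P \<union> ran_proj Q)))"

definition top_proj :: "'a proj" where "top = Proj (\<lambda>x. x)"

definition bot_proj :: "'a proj" where "bot = Proj (\<lambda>x. 0)"

definition uminus_proj :: "'a proj \<Rightarrow> 'a proj" where
  "- P = Proj (\<lambda>x. x - apply_proj P x)"

text \<open>The library convention for complemented lattices, not the difference of operators.\<close>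

definition minus_proj :: "'a proj \<Rightarrow> 'a proj \<Rightarrow> 'a proj" where
  "minus_proj P Q = inf P (- Q)"

lemma ran_Inf: "ran_proj (Inf A) = (\<Inter>P\<in>A. ran_proj P)" for A :: "'a proj set"
  unfolding Inf_proj_def
  by (rule ran_proj_onto) (auto intro!: closed_INT closed_ran_proj cvs.subspace_Int csubspace_ran_proj)

lemma ran_Sup: "ran_proj (Sup A) = closure (cspan (\<Union>P\<in>A. ran_proj P))" for A :: "'a proj set"
  unfolding Sup_proj_def by (rule ran_proj_onto) (auto intro!: csubspace_closure)

lemma ran_inf: "ran_proj (inf P Q) = ran_proj P \<inter> ran_proj Q" for P Q :: "'a proj"
  unfolding inf_proj_def
  by (rule ran_proj_onto) (auto intro!: closed_ran_proj cvs.subspace_inter csubspace_ran_proj)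

lemma ran_sup: "ran_proj (sup P Q) = closure (cspan (ran_proj P \<union> ran_proj Q))" for P Q :: "'a proj"
  unfolding sup_proj_def by (rule ran_proj_onto) (auto intro!: csubspace_closure)

lemma apply_top: "apply_proj (top :: 'a proj) x = x"
  unfolding top_proj_def by (subst Proj_inverse) auto

lemma apply_bot: "apply_proj (bot :: 'a proj) x = 0"
  unfolding bot_proj_def by (subst Proj_inverse) (auto simp: cinner_zero)

lemma apply_uminus: "apply_proj (- P) x = x - apply_proj P x" for P :: "'a proj"
  unfolding uminus_proj_def
  by (subst Proj_inverse)
    (auto simp: bounded_linear_sub bounded_linear_ident bounded_linear_proj proj_scaleC proj_idem
      cvs.scale_right_diff_distrib cinner_simps proj_selfadj
      proj_diff)

lemma ran_top: "ran_proj (top :: 'a proj) = UNIV"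
  by (auto simp: ran_proj_iff apply_top)

lemma ran_bot: "ran_proj (bot :: 'a proj) = {0}"
  by (auto simp: ran_proj_iff apply_bot)

lemma ran_uminus: "x \<in> ran_proj (- P) \<longleftrightarrow> apply_proj P x = 0" for P :: "'a proj"
  by (simp add: ran_proj_iff apply_uminus)

lemma closure_cspan_minimal: "closure (cspan A) \<subseteq> ran_proj P" if "A \<subseteq> ran_proj P" for P :: "'a proj"
  by (intro closure_minimal closed_ran_proj cvs.span_minimal that csubspace_ran_proj)

lemma subset_closure_cspan: "A \<subseteq> closure (cspan A)" for A :: "'a set"
  using closure_subset cvs.span_superset by blast

instance
proof
  fix x y z :: "'a proj" and A :: "'a proj set"
  show "(x < y) = (x \<le> y \<and> \<not> y \<le> x)" by (auto simp: less_proj_def less_eq_proj_def)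
  show "x \<le> x" by (simp add: less_eq_proj_def)
  show "x \<le> z" if "x \<le> y" "y \<le> z" using that by (auto simp: less_eq_proj_def)
  show "x = y" if "x \<le> y" "y \<le> x"
    using that by (auto simp: less_eq_proj_def simp flip: ran_proj_inject)
  show "inf x y \<le> x" "inf x y \<le> y" by (auto simp: less_eq_proj_def ran_inf)
  show "x \<le> inf y z" if "x \<le> y" "x \<le> z" using that by (auto simp: less_eq_proj_def ran_inf)
  show "x \<le> sup x y" "y \<le> sup x y"
    unfolding less_eq_proj_def ran_sup using subset_closure_cspan by blast+
  show "sup y z \<le> x" if "y \<le> x" "z \<le> x"
    using that unfolding less_eq_proj_def ran_sup by (intro closure_cspan_minimal) auto
  show "bot \<le> x" using cvs.subspace_0[OF csubspace_ran_proj] by (auto simp: less_eq_proj_def ran_bot)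
  show "x \<le> top" by (simp add: less_eq_proj_def ran_top)
  show "Inf A \<le> x" if "x \<in> A" using that by (auto simp: less_eq_proj_def ran_Inf)
  show "z \<le> Inf A" if "\<And>x. x \<in> A \<Longrightarrow> z \<le> x"
    using that by (auto simp: less_eq_proj_def ran_Inf)
  show "x \<le> Sup A" if "x \<in> A"
    unfolding less_eq_proj_def ran_Sup using subset_closure_cspan that by blast
  show "Sup A \<le> z" if "\<And>x. x \<in> A \<Longrightarrow> x \<le> z"
    using that unfolding less_eq_proj_def ran_Sup by (intro closure_cspan_minimal) auto
  show "Inf {} = (top :: 'a proj)"
    unfolding ran_proj_inject[symmetric] ran_Inf ran_top by simp
  show "Sup {} = (bot :: 'a proj)"
    unfolding ran_proj_inject[symmetric] ran_Sup ran_bot by simp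
  show "inf x (- x) = bot"
    unfolding ran_proj_inject[symmetric] ran_inf ran_bot
    by (auto simp: ran_proj_iff apply_uminus proj_zero)
  show "sup x (- x) = top"
  proof -
    have "v \<in> cspan (ran_proj x \<union> ran_proj (- x))" for v
    proof -
      have "apply_proj x v + apply_proj (- x) v \<in> cspan (ran_proj x \<union> ran_proj (- x))"
        by (intro cvs.span_add cvs.span_base) (auto simp: proj_mem_ran)
      then show ?thesis by (simp add: apply_uminus)
    qed
    then show ?thesis
      unfolding ran_proj_inject[symmetric] ran_sup ran_top using closure_subset by blast
  qed
  show "x - y = inf x (- y)" by (rule minus_proj_def)
  show "- (- x) = x"
    by (simp add: apply_uminus fun_eq_iff flip: apply_proj_inject)
  show "- y \<le> - x" if "x \<le> y"
    unfolding less_eq_proj_def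
  proof
    fix v assume "v \<in> ran_proj (- y)"
    then have 0: "apply_proj y v = 0" by (simp add: ran_uminus)
    have "cinner s (v - 0) = 0" if "s \<in> ran_proj x" for s
    proof -
      have "apply_proj y s = s"
        using that \<open>x \<le> y\<close> by (auto simp: less_eq_proj_def simp flip: ran_proj_iff)
      then have "cinner s v = cinner s (apply_proj y v)"
        by (metis proj_selfadj)
      then show ?thesis using 0 by (simp add: cinner_zero)
    qed
    then have "apply_proj x v = 0"
      unfolding proj_eq_iff_orth using cvs.subspace_0[OF csubspace_ran_proj] by blast
    then show "v \<in> ran_proj (- x)" by (simp add: ran_uminus)
  qed
  show "sup x (inf (- x) y) = y" if "x \<le> y"
  proof -
    have 1: "ran_proj x \<subseteq> ran_proj y" using that by (simp add: less_eq_proj_def)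
    have "v \<in> cspan (ran_proj x \<union> ran_proj (inf (- x) y))" if "v \<in> ran_proj y" for v
    proof -
      have "apply_proj x v \<in> ran_proj y"
        using 1 proj_mem_ran by blast
      then have "apply_proj (- x) v \<in> ran_proj y"
        using that by (simp add: apply_uminus cvs.subspace_diff csubspace_ran_proj)
      then have "apply_proj x v + apply_proj (- x) v \<in> cspan (ran_proj x \<union> ran_proj (inf (- x) y))"
        by (intro cvs.span_add cvs.span_base) (auto simp: proj_mem_ran ran_inf)
      then show ?thesis by (simp add: apply_uminus)
    qed
    then have "ran_proj y \<subseteq> ran_proj (sup x (inf (- x) y))"
      unfolding ran_sup using closure_subset by blast
    moreover have "ran_proj (sup x (inf (- x) y)) \<subseteq> ran_proj y"
      unfolding ran_sup using 1 by (intro closure_cspan_minimal) (auto simp: ran_inf)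
    ultimately show ?thesis
      unfolding ran_proj_inject[symmetric] by blast
  qed
qed

end


definition commutes :: "'a::complex_hilbert proj \<Rightarrow> 'a proj \<Rightarrow> bool" where
  "commutes P Q \<longleftrightarrow> apply_proj P \<circ> apply_proj Q = apply_proj Q \<circ> apply_proj P"

definition commutant :: "'a::complex_hilbert proj set \<Rightarrow> 'a proj set" where
  "commutant A = {P. \<forall>Q\<in>A. commutes P Q}"

definition is_logic :: "'a::complex_hilbert proj set \<Rightarrow> bool" where
  "is_logic Q \<longleftrightarrow> commutant (commutant Q) = Q"

definition qimp :: "'a::complex_hilbert proj \<Rightarrow> 'a proj \<Rightarrow> 'a proj" where
  "qimp P Q = sup (- P) (inf P Q)"

definition qiff :: "'a::complex_hilbert proj \<Rightarrow> 'a proj \<Rightarrow> 'a proj" where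
  "qiff P Q = inf (qimp P Q) (qimp Q P)"

definition cdom :: "'a::complex_hilbert proj set \<Rightarrow> 'a proj" where
  "cdom A = Sup {E \<in> commutant A. \<forall>P\<^sub>1\<in>A. \<forall>P\<^sub>2\<in>A. commutes (inf P\<^sub>1 E) (inf P\<^sub>2 E)}"


section \<open>Sets and quantum sets\<close>

text \<open>HOL has no type of all sets. The type \<open>('k, 'q) name\<close> consists of the hereditary sets of
  pairs (element, label), with labels in \<open>'q\<close>, that are well-founded, extensional, and of size at
  most that of \<open>'k\<close> at every level; it is built from trees with \<open>'k\<close>-indexed branching by
  identifying trees that denote the same set. The parameter \<open>'k\<close> bounds only the size of sets: it
  is left arbitrary. Every set of at most \<open>'k\<close> many pairs is realised, see \<open>pairs_mk_name\<close>.\<close>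

datatype ('k, 'q) tree = Tree (branches: "'k \<Rightarrow> (('k, 'q) tree \<times> 'q) option")

inductive tree_eq :: "('k, 'q) tree \<Rightarrow> ('k, 'q) tree \<Rightarrow> bool" where
  "(\<And>s q. (s, q) \<in> ran f \<Longrightarrow> \<exists>t. (t, q) \<in> ran g \<and> tree_eq s t) \<Longrightarrow>
   (\<And>t q. (t, q) \<in> ran g \<Longrightarrow> \<exists>s. (s, q) \<in> ran f \<and> tree_eq s t) \<Longrightarrow>
   tree_eq (Tree f) (Tree g)"

lemma tree_induct_ran [case_names Tree]:
  assumes "\<And>f. (\<And>s q. (s, q) \<in> ran f \<Longrightarrow> P s) \<Longrightarrow> P (Tree f)"
  shows "P t"
proof (induction t)
  case (Tree f)
  have "P s" if "(s, q) \<in> ran f" for s q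
  proof -
    obtain i where "f i = Some (s, q)"
      using \<open>(s, q) \<in> ran f\<close> by (auto simp: ran_def)
    then show ?thesis
      by (intro Tree.IH[of "Some (s, q)" "(s, q)"]) (auto intro: range_eqI[of _ _ i])
  qed
  then show ?case by (rule assms)
qed

lemma tree_eq_refl: "tree_eq t t"
  by (induction t rule: tree_induct_ran) (auto intro!: tree_eq.intros)

lemma tree_eq_sym: "tree_eq s t \<Longrightarrow> tree_eq t s"
  by (induction rule: tree_eq.induct) (rule tree_eq.intros; blast)

lemma tree_eq_trans: "tree_eq s t \<Longrightarrow> tree_eq t u \<Longrightarrow> tree_eq s u"
proof (induction arbitrary: u rule: tree_eq.induct)
  case (1 f g)
  from 1(3) obtain h where u: "u = Tree h"
    and h: "\<And>s q. (s, q) \<in> ran g \<Longrightarrow> \<exists>t. (t, q) \<in> ran h \<and> tree_eq s t"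
      "\<And>t q. (t, q) \<in> ran h \<Longrightarrow> \<exists>s. (s, q) \<in> ran g \<and> tree_eq s t"
    by (cases rule: tree_eq.cases) blast
  show ?case
    unfolding u by (rule tree_eq.intros) (meson 1 h)+
qed

quotient_type ('k, 'q) name = "('k, 'q) tree" / tree_eq
  by (intro equivpI reflpI sympI transpI) (auto intro: tree_eq_refl tree_eq_sym tree_eq_trans)

definition pairs :: "('k, 'q) name \<Rightarrow> (('k, 'q) name \<times> 'q) set" where
  "pairs u = map_prod abs_name id ` ran (branches (rep_name u))"

definition mk_name :: "(('k, 'q) name \<times> 'q) set \<Rightarrow> ('k, 'q) name" where
  "mk_name A = (THE u. pairs u = A)"

definition ndom :: "('k, 'q) name \<Rightarrow> ('k, 'q) name set" where
  "ndom u = fst ` pairs u"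

definition napp :: "('k, 'q) name \<Rightarrow> ('k, 'q) name \<Rightarrow> 'q" where
  "napp u x = (THE q. (x, q) \<in> pairs u)"

lemma abs_name_eq_iff: "abs_name s = abs_name t \<longleftrightarrow> tree_eq s t"
  by (rule name.abs_eq_iff)

lemma pairs_abs: "pairs (abs_name (Tree f)) = map_prod abs_name id ` ran f"
proof -
  obtain g where g: "rep_name (abs_name (Tree f)) = Tree g"
    by (cases "rep_name (abs_name (Tree f))")
  have "abs_name (Tree g) = abs_name (Tree f)"
    using Quotient_abs_rep[OF Quotient_name, of "abs_name (Tree f)"] g by simp
  then have "tree_eq (Tree g) (Tree f)"
    by (simp add: abs_name_eq_iff)
  then have 1: "\<And>s q. (s, q) \<in> ran g \<Longrightarrow> \<exists>t. (t, q) \<in> ran f \<and> tree_eq s t"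
    and 2: "\<And>t q. (t, q) \<in> ran f \<Longrightarrow> \<exists>s. (s, q) \<in> ran g \<and> tree_eq s t"
    by (auto elim: tree_eq.cases)
  have "map_prod abs_name id ` ran g = map_prod abs_name id ` ran f"
  proof (intro set_eqI iffI)
    fix p assume "p \<in> map_prod abs_name id ` ran g"
    then obtain s q where s: "(s, q) \<in> ran g" "p = (abs_name s, q)" by auto
    then obtain t where "(t, q) \<in> ran f" "abs_name s = abs_name t"
      using 1 by (metis abs_name_eq_iff)
    then show "p \<in> map_prod abs_name id ` ran f"
      using s(2) by (intro image_eqI[of _ _ "(t, q)"]) auto
  next
    fix p assume "p \<in> map_prod abs_name id ` ran f"
    then obtain t q where t: "(t, q) \<in> ran f" "p = (abs_name t, q)" by auto
    then obtain s where "(s, q) \<in> ran g" "abs_name s = abs_name t"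
      using 2 by (metis abs_name_eq_iff)
    then show "p \<in> map_prod abs_name id ` ran g"
      using t(2) by (intro image_eqI[of _ _ "(s, q)"]) auto
  qed
  then show ?thesis
    by (simp add: pairs_def g)
qed

lemma name_cases_tree: obtains f where "u = abs_name (Tree f)"
  by (metis Quotient_abs_rep[OF Quotient_name] tree.exhaust)

lemma pairs_inject: "pairs u = pairs v \<longleftrightarrow> u = v"
proof
  assume eq: "pairs u = pairs v"
  obtain f g where uv: "u = abs_name (Tree f)" "v = abs_name (Tree g)"
    by (metis name_cases_tree)
  have eq': "map_prod abs_name id ` ran f = map_prod abs_name id ` ran g"
    using eq by (simp add: uv pairs_abs)
  have "\<exists>t. (t, q) \<in> ran g \<and> tree_eq s t" if "(s, q) \<in> ran f" for s q
  proof -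
    have "(abs_name s, q) \<in> map_prod abs_name id ` ran g"
      unfolding eq'[symmetric] using that by force
    then show ?thesis by (auto simp: abs_name_eq_iff)
  qed
  moreover have "\<exists>s. (s, q) \<in> ran f \<and> tree_eq s t" if "(t, q) \<in> ran g" for t q
  proof -
    have "(abs_name t, q) \<in> map_prod abs_name id ` ran f"
      unfolding eq' using that by force
    then obtain s where "(s, q) \<in> ran f" "abs_name s = abs_name t" by auto
    then show ?thesis unfolding abs_name_eq_iff by blast
  qed
  ultimately show "u = v"
    unfolding uv abs_name_eq_iff by (intro tree_eq.intros)
qed simp

lemma image_ran: "h ` ran f = ran (map_option h \<circ> f)"
  by (force simp: ran_def)

lemma ex_pairs_ran: "\<exists>u. pairs u = ran f" for f :: "'k \<Rightarrow> (('k, 'q) name \<times> 'q) option"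
proof
  have "map_prod abs_name id ` ran (map_option (map_prod rep_name id) \<circ> f)
      = (\<lambda>p. map_prod abs_name id (map_prod rep_name id p)) ` ran f"
    unfolding image_ran[symmetric] by (rule image_image)
  also have "\<dots> = (\<lambda>p. p) ` ran f"
    by (rule image_cong) (simp_all add: prod_eq_iff Quotient_abs_rep[OF Quotient_name])
  finally show "pairs (abs_name (Tree (map_option (map_prod rep_name id) \<circ> f))) = ran f"
    unfolding pairs_abs by (simp only: image_ident)
qed

lemma pairs_eq_ran: "\<exists>f :: 'k \<Rightarrow> _ option. pairs u = ran f" for u :: "('k, 'q) name"
  unfolding pairs_def image_ran by blast

lemma mk_name_pairs: "mk_name (pairs u) = u"
  by (simp add: mk_name_def pairs_inject)

lemma pairs_mk_name: "pairs (mk_name (ran f)) = ran f"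
  for f :: "'k \<Rightarrow> (('k, 'q) name \<times> 'q) option"
proof -
  obtain u :: "('k, 'q) name" where "pairs u = ran f"
    using ex_pairs_ran by blast
  then show ?thesis
    using mk_name_pairs[of u] by simp
qed

lemma pairs_mk_name_image: "pairs (mk_name (h ` ndom v)) = h ` ndom v"
  for h :: "('k, 'p) name \<Rightarrow> ('k, 'q) name \<times> 'q" and v :: "('k, 'p) name"
proof -
  obtain f :: "'k \<Rightarrow> (('k, 'p) name \<times> 'p) option" where f: "pairs v = ran f"
    using pairs_eq_ran by blast
  have "h ` ndom v = ran (map_option (\<lambda>p. h (fst p)) \<circ> f)"
    unfolding ndom_def f image_ran[symmetric] by (rule image_image)
  then show ?thesis
    by (simp only: pairs_mk_name)
qed

lemma pairs_mk_name_countable: "countable A \<Longrightarrow> pairs (mk_name A) = A"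
  for A :: "(('k::infinite, 'q) name \<times> 'q) set"
proof -
  assume A: "countable A"
  obtain e :: "nat \<Rightarrow> 'k" where e: "inj e"
    using infinite_countable_subset[OF infinite_UNIV] by blast
  define f where "f i = (if i \<in> e ` to_nat_on A ` A then Some (from_nat_into A (inv e i)) else None)" for i
  have f_e: "f (e (to_nat_on A a)) = Some a" if "a \<in> A" for a
    using that A e by (simp add: f_def)
  have "A = ran f"
  proof
    show "A \<subseteq> ran f"
      using ranI[of f, OF f_e] by blast
    show "ran f \<subseteq> A"
    proof
      fix a assume "a \<in> ran f"
      then obtain i where i: "f i = Some a" by (auto simp: ran_def)
      then obtain b where b: "b \<in> A" "i = e (to_nat_on A b)"
        by (auto simp: f_def split: if_splits)
      then show "a \<in> A"
        using f_e i by simp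
    qed
  qed
  then show ?thesis
    by (simp only: pairs_mk_name)
qed

definition name_rel :: "(('k, 'q) name \<times> ('k, 'q) name) set" where
  "name_rel = {(x, u). x \<in> ndom u}"

lemma wf_name_rel: "wf name_rel"
proof (rule wfUNIVI)
  fix P and u :: "('k, 'q) name"
  assume IH: "\<forall>u::('k, 'q) name. (\<forall>x. (x, u) \<in> name_rel \<longrightarrow> P x) \<longrightarrow> P u"
  have "P (abs_name t)" for t :: "('k, 'q) tree"
  proof (induction t rule: tree_induct_ran)
    case (Tree f)
    then show ?case
      by (intro IH[rule_format, of "abs_name (Tree f)"]) (auto simp: name_rel_def ndom_def pairs_abs)
  qed
  then show "P u"
    using name_cases_tree[of u] by blast
qed

lemma name_rel_iff [simp]: "(x, u) \<in> name_rel \<longleftrightarrow> x \<in> ndom u"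
  by (simp add: name_rel_def)

type_synonym 'k zset = "('k, unit) name"

text \<open>The union of the cumulative levels of \<open>Q\<close>-valued functions, as a least fixed point.\<close>

inductive_set VQ :: "'a::complex_hilbert proj set \<Rightarrow> ('k, 'a proj) name set"
  for Q :: "'a proj set" where
  "single_valued (pairs u) \<Longrightarrow> (\<And>x q. (x, q) \<in> pairs u \<Longrightarrow> x \<in> VQ Q) \<Longrightarrow>
   (\<And>x q. (x, q) \<in> pairs u \<Longrightarrow> q \<in> Q) \<Longrightarrow> u \<in> VQ Q"

context
  notes image_cong [fundef_cong]
begin

function supp :: "('k, 'a::complex_hilbert proj) name \<Rightarrow> 'a proj set" where
  "supp u = (\<Union>x\<in>ndom u. supp x) \<union> {napp u x |x. x \<in> ndom u}"
  by pat_completeness auto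
termination
  by (relation name_rel) (simp_all add: wf_name_rel)

function check :: "'k zset \<Rightarrow> ('k, 'a::complex_hilbert proj) name" where
  "check v = mk_name ((\<lambda>w. (check w, top)) ` ndom v)"
  by pat_completeness auto
termination
  by (relation name_rel) (simp_all add: wf_name_rel)

function eq_tv :: "('k, 'a::complex_hilbert proj) name \<Rightarrow> ('k, 'a proj) name \<Rightarrow> 'a proj"
  and mem_tv :: "('k, 'a::complex_hilbert proj) name \<Rightarrow> ('k, 'a proj) name \<Rightarrow> 'a proj" where
  "eq_tv u v = inf (INF x\<in>ndom u. qimp (napp u x) (mem_tv x v))
                   (INF y\<in>ndom v. qimp (napp v y) (mem_tv y u))"
| "mem_tv u v = (SUP y\<in>ndom v. inf (napp v y) (eq_tv u y))"
  by pat_completeness auto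
termination
proof (relation "inv_image (mult name_rel) (\<lambda>p. case p of Inl (u, v) \<Rightarrow> {#u, v#} | Inr (u, v) \<Rightarrow> {#u, v#})",
    goal_cases)
  case 1
  show ?case by (intro wf_inv_image wf_mult wf_name_rel)
next
  case (2 u v x)
  have "({#v#} + {#x#}, {#v#} + {#u#}) \<in> mult name_rel"
    using 2 by (intro one_step_implies_mult) auto
  then show ?case by (simp add: add_mset_commute)
next
  case (3 u v y)
  have "({#u#} + {#y#}, {#u#} + {#v#}) \<in> mult name_rel"
    using 3 by (intro one_step_implies_mult) auto
  then show ?case by (simp add: add_mset_commute)
next
  case (4 u v y)
  have "({#u#} + {#y#}, {#u#} + {#v#}) \<in> mult name_rel"
    using 4 by (intro one_step_implies_mult) auto
  then show ?case by (simp add: add_mset_commute)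
qed

end

declare supp.simps [simp del] check.simps [simp del] eq_tv.simps [simp del] mem_tv.simps [simp del]

lemma pairs_check: "pairs (check v) = (\<lambda>w. (check w, top)) ` ndom v"
  by (subst check.simps) (rule pairs_mk_name_image)

lemma ndom_check: "ndom (check v) = check ` ndom v"
  unfolding ndom_def[of "check v"] pairs_check by (simp add: image_image)

lemma napp_check: "w \<in> ndom v \<Longrightarrow> napp (check v) (check w) = top"
  unfolding napp_def pairs_check by (rule the_equality) auto

definition Or :: "('k, 'a::complex_hilbert proj) name \<Rightarrow> 'a proj" where
  "Or u = cdom (supp u)"


section \<open>Bounded formulas and quantum reals\<close>

text \<open>Formulas with constants from \<open>'v\<close>; bounded quantifiers bind by a function that maps an
  element of the universe to the corresponding instance. \<open>Less\<close> is the order of the rationals.\<close>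

datatype 'v fm =
    Eq 'v 'v
  | Mem 'v 'v
  | Less 'v 'v
  | Neg "'v fm"
  | Con "'v fm" "'v fm"
  | Dis "'v fm" "'v fm"
  | Imp "'v fm" "'v fm"
  | Iff "'v fm" "'v fm"
  | BAll 'v "'v \<Rightarrow> 'v fm"
  | BEx 'v "'v \<Rightarrow> 'v fm"

text \<open>The map \<open>code\<close> is the chosen construction of the rationals as sets; only its injectivity
  is ever assumed. On names that are not of the form \<open>check (code r)\<close>, where \<open>Less\<close> is never
  evaluated below, its truth value is set to 0.\<close>

primrec tv :: "(rat \<Rightarrow> 'k zset) \<Rightarrow> ('k, 'a::complex_hilbert proj) name fm \<Rightarrow> 'a proj" where
  "tv code (Eq u v) = eq_tv u v"
| "tv code (Mem u v) = mem_tv u v"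
| "tv code (Less u v) =
     (if \<exists>r s. u = check (code r) \<and> v = check (code s) \<and> r < s then top else bot)"
| "tv code (Neg \<phi>) = - tv code \<phi>"
| "tv code (Con \<phi> \<psi>) = inf (tv code \<phi>) (tv code \<psi>)"
| "tv code (Dis \<phi> \<psi>) = sup (tv code \<phi>) (tv code \<psi>)"
| "tv code (Imp \<phi> \<psi>) = qimp (tv code \<phi>) (tv code \<psi>)"
| "tv code (Iff \<phi> \<psi>) = qiff (tv code \<phi>) (tv code \<psi>)"
| "tv code (BAll u \<phi>) = (INF x\<in>ndom u. qimp (napp u x) (tv code (\<phi> x)))"
| "tv code (BEx u \<phi>) = (SUP x\<in>ndom u. inf (napp u x) (tv code (\<phi> x)))"

definition rat_set :: "(rat \<Rightarrow> 'k::infinite zset) \<Rightarrow> 'k zset" where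
  "rat_set code = mk_name (range (\<lambda>r. (code r, ())))"

lemma ndom_rat_set: "ndom (rat_set code) = range code"
  unfolding ndom_def rat_set_def
  by (subst pairs_mk_name_countable) (simp_all add: image_image)

definition Subset :: "'v \<Rightarrow> 'v \<Rightarrow> 'v fm" where
  "Subset x y = BAll x (\<lambda>z. Mem z y)"

definition real_fm ::
    "(rat \<Rightarrow> 'k::infinite zset) \<Rightarrow> ('k, 'a::complex_hilbert proj) name \<Rightarrow> ('k, 'a proj) name fm" where
  "real_fm code x =
     (let Q = check (rat_set code) in
      Con (Subset x Q)
     (Con (BEx Q (\<lambda>y. Mem y x))
     (Con (BEx Q (\<lambda>y. Neg (Mem y x)))
          (BAll Q (\<lambda>y. Iff (Mem y x) (BAll Q (\<lambda>z. Imp (Less y z) (Mem z x))))))))"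

definition quantum_reals ::
    "(rat \<Rightarrow> 'k::infinite zset) \<Rightarrow> 'a::complex_hilbert proj set \<Rightarrow> ('k, 'a proj) name set" where
  "quantum_reals code Q =
     {u \<in> VQ Q. ndom u = range (\<lambda>r. check (code r)) \<and> tv code (real_fm code u) = top}"

end

theory Submission
  imports Defs
begin

text \<open>Check names are two-valued, so only the term \<open>y = check (code r)\<close> contributes to
  \<open>\<lbrakk>check (code r) \<in> u\<rbrakk>\<close>. Since \<open>P \<Rightarrow> Q\<close> has truth value 1 exactly if \<open>P \<le> Q\<close>, the last
  clause of the definition of a real makes \<open>r \<mapsto> u (check (code r))\<close> monotone. Its values form a
  chain of projections, and comparable projections commute.\<close>

text \<open>By De Morgan, the complement of \<open>qimp P Q\<close> is the part of \<open>P\<close>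
  orthogonal to \<open>inf P Q\<close>. When it vanishes, the orthomodular law, standing in for
  distributivity, gives \<open>inf P Q = P\<close>.\<close>

lemma qimp_eq_top_iff: "qimp P Q = top \<longleftrightarrow> P \<le> Q"
proof
  assume "qimp P Q = top"
  then have "- qimp P Q = bot" by simp
  then have "inf (- inf P Q) P = bot"
    by (simp add: qimp_def inf_commute)
  with orthomodular[of "inf P Q" P] have "inf P Q = P" by simp
  then show "P \<le> Q" by (simp add: inf.absorb_iff1)
next
  assume "P \<le> Q"
  then show "qimp P Q = top" by (simp add: qimp_def inf.absorb1)
qed

lemma qimp_top_left: "qimp top P = P"
  by (simp add: qimp_def)

lemma qiff_eq_top_iff: "qiff P Q = top \<longleftrightarrow> P = Q"
  by (auto simp: qiff_def inf_eq_top_iff qimp_eq_top_iff)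

lemma commutes_sym: "commutes P Q \<Longrightarrow> commutes Q P"
  by (simp add: commutes_def)

text \<open>\<open>Q\<close> fixes the range of \<open>P\<close>, so QP = P. For \<open>s\<close> in
  that range, <s, Qx> = <Qs, x> = <s, x> = <s, Px>; hence Qx - Px is orthogonal to the range and PQ
  = P.\<close>

lemma commutes_if_le:
  assumes "P \<le> Q"
  shows "commutes P Q"
proof -
  have QP: "apply_proj Q (apply_proj P x) = apply_proj P x" for x
    using assms proj_mem_ran[of P x] by (auto simp: less_eq_proj_def simp flip: ran_proj_iff)
  have "apply_proj P (apply_proj Q x) = apply_proj P x" for x
    unfolding proj_eq_iff_orth
  proof (intro conjI ballI proj_mem_ran)
    fix s assume s: "s \<in> ran_proj P"
    then have Ps: "apply_proj P s = s" by (simp add: ran_proj_iff)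
    have "cinner s (apply_proj Q x) = cinner s x"
      using QP[of s] by (simp add: Ps flip: proj_selfadj)
    moreover have "cinner s (apply_proj P x) = cinner s x"
      by (simp add: Ps flip: proj_selfadj)
    ultimately show "cinner s (apply_proj Q x - apply_proj P x) = 0"
      by (simp add: cinner_diff_right)
  qed
  then show ?thesis
    by (simp add: commutes_def fun_eq_iff QP)
qed

text \<open>The projection 1 itself is admissible in the supremum: it commutes with everything, and
  meeting with it changes nothing.\<close>

lemma cdom_eq_top:
  assumes "\<And>P Q. P \<in> A \<Longrightarrow> Q \<in> A \<Longrightarrow> commutes P Q"
  shows "cdom A = top"
proof (rule antisym)
  show "top \<le> cdom A"
    unfolding cdom_def using assms
    by (intro Sup_upper) (auto simp: commutant_def intro: commutes_sym[OF commutes_if_le])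
qed simp

lemma zset_eq_iff: "v = w \<longleftrightarrow> ndom v = ndom w" for v w :: "'k zset"
proof
  have "pairs x = (\<lambda>y. (y, ())) ` ndom x" for x :: "'k zset"
    by (force simp: ndom_def)
  then show "ndom v = ndom w \<Longrightarrow> v = w"
    by (metis pairs_inject)
qed simp

lemma eq_tv_commute: "eq_tv u v = eq_tv v u"
  by (simp add: eq_tv.simps inf_commute)

text \<open>Equality is assumed two-valued only against elements of the domain of \<open>u\<close>,
  so that the lemma can also be applied to induction hypotheses in the proof of
  \<open>eq_tv_check\<close>.\<close>

lemma mem_tv_check:
  fixes u :: "('k, 'a::complex_hilbert proj) name"
  assumes "ndom u \<subseteq> range check"
    and "\<And>w. check w \<in> ndom u \<Longrightarrow>
      eq_tv (check v :: ('k, 'a proj) name) (check w) = (if v = w then top else bot)"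
  shows "mem_tv (check v) u = (if check v \<in> ndom u then napp u (check v) else bot)"
proof -
  have "inf (napp u y) (eq_tv (check v) y) \<le> (if check v \<in> ndom u then napp u (check v) else bot)"
    if "y \<in> ndom u" for y
  proof -
    from that assms(1) obtain w where "y = check w" by blast
    with that assms(2)[of w] show ?thesis by auto
  qed
  moreover have "napp u (check v) \<le> mem_tv (check v) u" if "check v \<in> ndom u"
    unfolding mem_tv.simps using that assms(2)[OF that] by (intro SUP_upper2[OF that]) simp
  ultimately show ?thesis
    by (intro antisym) (simp add: mem_tv.simps SUP_le_iff, simp)
qed

lemma inj_check: "inj (check :: 'k zset \<Rightarrow> ('k, 'a::complex_hilbert proj) name)"
proof (rule injI)
  fix v w :: "'k zset"
  assume "(check v :: ('k, 'a proj) name) = check w"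
  then show "v = w"
  proof (induction v arbitrary: w rule: wf_induct_rule[OF wf_name_rel])
    case (1 v)
    have "(check ` ndom v :: ('k, 'a proj) name set) = check ` ndom w"
      using 1(2) by (metis ndom_check)
    then have "x \<in> ndom v \<longleftrightarrow> x \<in> ndom w" for x
      using 1(1) by (auto simp: set_eq_iff image_iff) metis+
    then show ?case
      by (auto simp: zset_eq_iff)
  qed
qed

lemma eq_tv_check:
  "eq_tv (check v :: ('k, 'a::complex_hilbert proj) name) (check w) = (if v = w then top else bot)"
proof (induction v arbitrary: w rule: wf_induct_rule[OF wf_name_rel])
  case (1 v)
  \<comment> \<open>The two alternatives match the two halves of \<open>eq_tv\<close>: elements of
    \<open>v\<close> tested in \<open>w\<close>, and elements of \<open>w\<close> tested in
    \<open>v\<close>. In the second, the induction hypothesis has the smaller name on the left, so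
    equality is first turned around.\<close>
  have mem: "mem_tv (check x :: ('k, 'a proj) name) (check y) = (if x \<in> ndom y then top else bot)"
    if "x \<in> ndom v \<or> y = v" for x y
  proof -
    have "eq_tv (check x :: ('k, 'a proj) name) (check z) = (if x = z then top else bot)"
      if "z \<in> ndom y" for z
      using \<open>x \<in> ndom v \<or> y = v\<close>
    proof
      assume "y = v"
      with that have "eq_tv (check z :: ('k, 'a proj) name) (check x) = (if z = x then top else bot)"
        using 1 by simp
      then show ?thesis by (subst eq_tv_commute) auto
    qed (use 1 in simp)
    then show ?thesis
      by (subst mem_tv_check) (auto simp: ndom_check napp_check inj_image_mem_iff[OF inj_check])
  qed
  have "eq_tv (check v :: ('k, 'a proj) name) (check w) =
      inf (INF x\<in>ndom v. if x \<in> ndom w then top else bot) (INF y\<in>ndom w. if y \<in> ndom v then top else bot)"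
    unfolding eq_tv.simps ndom_check image_image
    by (intro arg_cong2[of _ _ _ _ inf] INF_cong refl) (auto simp: napp_check qimp_top_left mem)
  also have "\<dots> = (if v = w then top else bot)"
  proof (cases "v = w")
    case False
    then consider x where "x \<in> ndom v" "x \<notin> ndom w" | x where "x \<in> ndom w" "x \<notin> ndom v"
      unfolding zset_eq_iff by blast
    then have "inf (INF x\<in>ndom v. if x \<in> ndom w then top else bot)
        (INF y\<in>ndom w. if y \<in> ndom v then top else bot) \<le> (bot :: 'a proj)"
    proof cases
      case 1
      then show ?thesis by (intro le_infI1 INF_lower2[of x]) simp_all
    next
      case 2
      then show ?thesis by (intro le_infI2 INF_lower2[of x]) simp_all
    qed
    with False show ?thesis by (simp only: bot_unique if_False)
  qed simp
  finally show ?case .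
qed

text \<open>Every label in a check name is 1. Equality can fail, since the check of the empty set
  has empty support.\<close>

lemma supp_check: "supp (check v :: ('k, 'a::complex_hilbert proj) name) \<subseteq> {top}"
  by (induction v rule: wf_induct_rule[OF wf_name_rel])
    (subst supp.simps, auto simp: ndom_check napp_check)

theorem theorem5p1:
  fixes Q :: "'a::complex_hilbert proj set"
    and code :: "rat \<Rightarrow> 'k::infinite zset"
    and u :: "('k, 'a proj) name"
  assumes "is_logic Q" and "inj code" and "u \<in> quantum_reals code Q"
  shows "(\<forall>r. napp u (check (code r)) = tv code (Mem (check (code r)) u)) \<and> Or u = top"
proof
  have dom: "ndom u = range (\<lambda>r. check (code r))" and real: "tv code (real_fm code u) = top"
    using assms(3) by (auto simp: quantum_reals_def)
  have mem: "mem_tv (check (code r)) u = napp u (check (code r))" for r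
    using dom by (subst mem_tv_check) (auto simp: eq_tv_check)
  then show "\<forall>r. napp u (check (code r)) = tv code (Mem (check (code r)) u)"
    by simp
  \<comment> \<open>The last clause of \<open>real_fm\<close> is an infimum of biconditionals. As it
    is 1, each biconditional is 1, and so its two sides are equal.\<close>
  have cut: "napp u (check (code r)) = (INF s. qimp
      (tv code (Less (check (code r)) (check (code s)) :: ('k, 'a proj) name fm)) (napp u (check (code s))))" for r
  proof -
    have "napp (check (rat_set code) :: ('k, 'a proj) name) (check (code r)) = top" for r
      by (simp add: napp_check ndom_rat_set)
    then have "(INF r. qiff (napp u (check (code r))) (INF s. qimp
        (tv code (Less (check (code r)) (check (code s)) :: ('k, 'a proj) name fm)) (napp u (check (code s))))) = top"
      using real
      by (simp add: real_fm_def Let_def inf_eq_top_iff ndom_check ndom_rat_set image_image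
          qimp_top_left mem del: tv.simps(3))
    then show ?thesis
      by (simp only: INF_top_conv qiff_eq_top_iff) blast
  qed
  \<comment> \<open>For \<open>r < s\<close> the antecedent is 1, so the value at \<open>s\<close>
    is itself a term of the infimum in \<open>cut\<close> for \<open>r\<close>.\<close>
  have mono: "napp u (check (code r)) \<le> napp u (check (code s))" if "r < s" for r s
  proof -
    have "tv code (Less (check (code r)) (check (code s)) :: ('k, 'a proj) name fm) = top"
      using that by auto
    then show ?thesis
      by (subst cut) (rule INF_lower2[of s], simp_all only: UNIV_I qimp_top_left order_refl)
  qed
  have "commutes (napp u (check (code r))) (napp u (check (code s)))" for r s
    using mono[of r s] mono[of s r] by (cases r s rule: linorder_cases)
      (auto intro: commutes_if_le commutes_sym[OF commutes_if_le])
  \<comment> \<open>\<open>top\<close> joins the chain because the support of \<open>u\<close>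
    includes the supports of the check names in its domain.\<close>
  then have "commutes P P'"
    if "P \<in> insert top (range (\<lambda>r. napp u (check (code r))))"
      "P' \<in> insert top (range (\<lambda>r. napp u (check (code r))))" for P P'
    using that by (auto intro: commutes_if_le commutes_sym[OF commutes_if_le])
  moreover have "supp u \<subseteq> insert top (range (\<lambda>r. napp u (check (code r))))"
  proof -
    have "supp u = (\<Union>r. supp (check (code r))) \<union> range (\<lambda>r. napp u (check (code r)))"
      by (subst supp.simps) (auto simp: dom)
    then show ?thesis using supp_check by blast
  qed
  ultimately show "Or u = top"
    unfolding Or_def by (intro cdom_eq_top) (meson subsetD)
qed

end
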